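(* Let $B(z,u,v)=\sum_D z^{|D|-1}u^{\mathrm{top}(D)}v^{\mathrm{cr}(D)}$, the sum running over all rooted indecomposable chord diagrams $D$, and let $C(z,u,v)$ be the same sum restricted to connected chord diagrams. Then $$B(z,u,v)=u+z\,B(z,1+uv,v)\,B(z,u,v),$$ $$C(z,u,v)=u+z\big(C(z,1+uv,v)-C(z,1,v)\big)\,C(z,u,v).$$
   Context: A rooted chord diagram of size $|D|=n$ is a perfect matching of $\{0<\dots<2n-1\}$ into $n$ chords $(a,b)$, $a<b$, up to isomorphism. Chords $(a,b),(c,d)$ cross if $a<c<b<d$ or $c<a<d<b$; $\mathrm{cr}(D)$ is the number of unordered crossing pairs. A chord $(a,b)$ is below $(c,d)$ if $c<a<b<d$; a top chord is a chord not below any other chord, and $\mathrm{top}(D)$ is their number. A diagram is connected if its crossing graph on chords is connected, and indecomposable if it is not the side-by-side concatenation of two nonempty diagrams. *)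

theory Defs
  imports "HOL-Computational_Algebra.Formal_Power_Series"
begin

text \<open>A rooted chord diagram of size n: a perfect matching of {0..<2n} into chords (a,b), a<b.
  Rooted diagrams on the linearly ordered points have no nontrivial isomorphisms, so they are
  identified with the matchings themselves.\<close>

definition chord_diagram :: "nat \<Rightarrow> (nat \<times> nat) set \<Rightarrow> bool" where
  "chord_diagram n D \<longleftrightarrow>
     D \<subseteq> {(a, b). a < b \<and> b < 2 * n} \<and>
     (\<forall>x < 2 * n. \<exists>!c. c \<in> D \<and> (fst c = x \<or> snd c = x))"

definition crosses :: "nat \<times> nat \<Rightarrow> nat \<times> nat \<Rightarrow> bool" where
  "crosses c1 c2 \<longleftrightarrow>
     (fst c1 < fst c2 \<and> fst c2 < snd c1 \<and> snd c1 < snd c2) \<or>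
     (fst c2 < fst c1 \<and> fst c1 < snd c2 \<and> snd c2 < snd c1)"

text \<open>Number of unordered crossing pairs.\<close>
definition cr :: "(nat \<times> nat) set \<Rightarrow> nat" where
  "cr D = card {{c1, c2} | c1 c2. c1 \<in> D \<and> c2 \<in> D \<and> crosses c1 c2}"

definition below :: "nat \<times> nat \<Rightarrow> nat \<times> nat \<Rightarrow> bool" where
  "below c1 c2 \<longleftrightarrow> fst c2 < fst c1 \<and> snd c1 < snd c2"

definition top_chords :: "(nat \<times> nat) set \<Rightarrow> nat" where
  "top_chords D = card {c \<in> D. \<not> (\<exists>d \<in> D. below c d)}"

text \<open>Connected: the crossing graph on the chords is connected.\<close>
definition connected_cd :: "(nat \<times> nat) set \<Rightarrow> bool" where
  "connected_cd D \<longleftrightarrow>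
     (\<forall>c1 \<in> D. \<forall>c2 \<in> D. (c1, c2) \<in> {(x, y). x \<in> D \<and> y \<in> D \<and> crosses x y}\<^sup>*)"

text \<open>Indecomposable (for a diagram of size n): not a side-by-side concatenation of two
  nonempty diagrams, i.e. there is no cut point k with 0<k<2n such that every chord lies
  entirely left of k or entirely right of it.\<close>
definition indecomposable :: "nat \<Rightarrow> (nat \<times> nat) set \<Rightarrow> bool" where
  "indecomposable n D \<longleftrightarrow>
     \<not> (\<exists>k. 0 < k \<and> k < 2 * n \<and> (\<forall>c \<in> D. snd c < k \<or> k \<le> fst c))"

text \<open>Coefficient of z^m: sum over diagrams D of size m+1 (so |D|-1 = m).\<close>
definition B_coeff :: "nat \<Rightarrow> 'a::comm_ring_1 \<Rightarrow> 'a \<Rightarrow> 'a" where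
  "B_coeff m u v = (\<Sum>D \<in> {D. chord_diagram (Suc m) D \<and> indecomposable (Suc m) D}.
                      u ^ top_chords D * v ^ cr D)"

definition C_coeff :: "nat \<Rightarrow> 'a::comm_ring_1 \<Rightarrow> 'a \<Rightarrow> 'a" where
  "C_coeff m u v = (\<Sum>D \<in> {D. chord_diagram (Suc m) D \<and> connected_cd D}.
                      u ^ top_chords D * v ^ cr D)"

definition B_gf :: "'a::comm_ring_1 \<Rightarrow> 'a \<Rightarrow> 'a fps" where
  "B_gf u v = Abs_fps (\<lambda>m. B_coeff m u v)"

definition C_gf :: "'a::comm_ring_1 \<Rightarrow> 'a \<Rightarrow> 'a fps" where
  "C_gf u v = Abs_fps (\<lambda>m. C_coeff m u v)"

end

theory Submission
  imports Defs
begin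

text \<open>
  Read the diagram from left to right. If h chords are open and the next point closes the one
  that has j later-opened open chords, then this chord crosses exactly these j chords among
  those still open, and it is a top chord iff it is the earliest open one, i.e. j = h - 1. Hence
  closing at height h has total weight 1 + v + ... + v^(h-2) + u v^(h-1), and replacing u by
  1 + u v turns this into the weight at height h + 1. Indecomposable diagrams correspond to paths
  that return to height 0 only at the end, so cutting after the first step at the first return
  to height 1 yields the equation for B.

  A diagram is connected iff no interval of points that avoids the root point is closed under
  the matching. Along the scan this is controlled by the set K of numbers of open chords to the
  right of a cut position p > 0 that no closed chord spans; K must never contain 0.
  In the decomposition at the first return to height 1, the lifted part is a connected diagram in
  which a nonempty set of closings of the earliest open chord is redirected to the root chord:
  this is C(z,1+uv,v) - C(z,1,v).
\<close>

section \<open>The weighted scan\<close>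

definition close_wt :: "'a::comm_ring_1 \<Rightarrow> 'a \<Rightarrow> nat \<Rightarrow> nat \<Rightarrow> 'a" where
  "close_wt u v h j = (if Suc j = h then u else 1) * v ^ j"

text \<open>Closing a chord with \<open>j\<close> later-opened open chords spans exactly the cuts
  that have at most \<open>j\<close> open chords to their right. The surviving cuts lie left of its
  opening point and lose one open chord.\<close>

definition close_cuts :: "nat \<Rightarrow> nat set \<Rightarrow> nat set" where
  "close_cuts j K = (\<lambda>k. k - 1) ` {k \<in> K. j < k}"

text \<open>
  Weight of all completions with l points to go, h open chords and set K of cut sizes. The flag
  selects whether dead cuts (0 \<in> K) are forbidden, i.e. connected versus indecomposable.
\<close>
fun scan_sum :: "bool \<Rightarrow> 'a::comm_ring_1 \<Rightarrow> 'a \<Rightarrow> nat \<Rightarrow> nat \<Rightarrow> nat set \<Rightarrow> 'a" where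
  "scan_sum c u v 0 h K = (if h = 0 \<and> \<not> (c \<and> 0 \<in> K) then 1 else 0)"
| "scan_sum c u v (Suc l) h K =
     (if h = 0 \<or> c \<and> 0 \<in> K then 0
      else scan_sum c u v l (Suc h) (insert 1 (Suc ` K)) +
           (\<Sum>j<h. close_wt u v h j * scan_sum c u v l (h - 1) (close_cuts j K)))"

lemma scan_sum_dead: "c \<Longrightarrow> 0 \<in> K \<Longrightarrow> scan_sum c u v l h K = 0"
  by (cases l) auto

lemma scan_sum_no_open: "\<not> (c \<and> 0 \<in> K) \<Longrightarrow> scan_sum c u v l 0 K = (if l = 0 then 1 else 0)"
  by (cases l) auto

lemma scan_sum_step:
  assumes "0 < h" "\<not> (c \<and> 0 \<in> K)"
  shows "scan_sum c u v (Suc l) h K = scan_sum c u v l (Suc h) (insert 1 (Suc ` K)) +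
           (\<Sum>j<h. close_wt u v h j * scan_sum c u v l (h - 1) (close_cuts j K))"
  by (subst scan_sum.simps, subst if_not_P) (use assms in auto)

lemma scan_sum_parity: "odd (l + h) \<Longrightarrow> scan_sum c u v l h K = 0"
proof (induction l arbitrary: h K)
  case 0
  then show ?case by (cases h) auto
next
  case (Suc l)
  have "scan_sum c u v l (h - 1) K' = 0" if "h \<noteq> 0" for K'
    using Suc.prems that by (intro Suc.IH) (cases h, auto)
  moreover have "scan_sum c u v l (Suc h) K' = 0" for K'
    using Suc.prems by (intro Suc.IH) auto
  ultimately show ?case by simp
qed

text \<open>Without the flag the cut set is carried along but never tested.\<close>

lemma scan_sum_False: "scan_sum False u v l h K = scan_sum False u v l h K'"
proof (induction l arbitrary: h K K')
  case (Suc l)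
  show ?case
    unfolding scan_sum.simps
    by (intro if_cong refl arg_cong2[of _ _ _ _ "(+)"] arg_cong2[of _ _ _ _ "(*)"] sum.cong Suc.IH) auto
qed auto

lemma close_cuts_subset: "K \<subseteq> {..<h} \<Longrightarrow> close_cuts j K \<subseteq> {..<h - 1}"
  unfolding close_cuts_def by auto

lemma close_cuts_empty: "K \<subseteq> {..<h} \<Longrightarrow> h \<le> Suc j \<Longrightarrow> close_cuts j K = {}"
  unfolding close_cuts_def by auto

text \<open>At height \<open>Suc h\<close> the number \<open>h\<close> is the size of the cut just
  after the opening of the bottom chord. It survives the closing of any other chord and follows the
  height down.\<close>

lemma close_cuts_insert: "j < h \<Longrightarrow> close_cuts j (insert h K) = insert (h - 1) (close_cuts j K)"
  unfolding close_cuts_def by auto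

section \<open>Cutting a scan at its first return to height 1\<close>

lemma sum_close_split:
  fixes f :: "nat \<Rightarrow> 'a::comm_ring_1"
  shows "(\<Sum>j<Suc h. close_wt u v (Suc h) j * f j) = (\<Sum>j<h. v ^ j * f j) + u * v ^ h * f h"
  by (simp add: close_wt_def)

lemma conv_Suc:
  fixes a b :: "nat \<Rightarrow> 'a::comm_ring_1"
  assumes "a 0 = 0"
  shows "(\<Sum>i\<le>Suc l. a i * b (Suc l - i)) = (\<Sum>i\<le>l. a (Suc i) * b (l - i))"
  using assms by (simp add: sum.atMost_Suc_shift del: sum.atMost_Suc)

text \<open>After \<open>i\<close> points the scan first reaches height 1; up to then it is a scan
  from height \<open>h\<close> lifted by one. The bound on \<open>K\<close> places every cut to the
  right of at least two open chords. Every step of the lifted scan preserves this, so no cut is left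
  at the return and the rest starts from \<open>{}\<close>.\<close>

lemma scan_sum_shift:
  assumes "K \<subseteq> {..<h}"
  shows "scan_sum c u v l (Suc h) K =
    (\<Sum>i\<le>l. scan_sum c (1 + u * v) v i h K * scan_sum c u v (l - i) 1 {})"
  using assms
proof (induction l arbitrary: h K)
  case 0
  then show ?case by (cases h) auto
next
  case (Suc l)
  let ?u = "1 + u * v"
  let ?b = "\<lambda>i. scan_sum c u v i 1 {}"
  show ?case
  proof (cases "h = 0 \<or> c \<and> 0 \<in> K")
    case True
    show ?thesis
    proof (cases "c \<and> 0 \<in> K")
      case True
      then show ?thesis by (simp add: scan_sum_dead del: sum.atMost_Suc)
    next
      case False
      with True have h: "h = 0" by simp
      with Suc.prems have K: "K = {}" by simp
      \<comment> \<open>At lifted height 0 only the empty scan has nonzero weight, so the return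
        happens at once.\<close>
      have "(\<Sum>i\<le>Suc l. scan_sum c ?u v i 0 {} * ?b (Suc l - i)) = (\<Sum>i\<le>Suc l. if i = 0 then ?b (Suc l) else 0)"
        by (rule sum.cong) (auto simp: scan_sum_no_open)
      then show ?thesis by (simp add: h K del: sum.atMost_Suc)
    qed
  next
    case False
    then obtain g where h: "h = Suc g" by (cases h) auto
    have nd: "\<not> (c \<and> 0 \<in> K)" using False by simp
    have open': "insert 1 (Suc ` K) \<subseteq> {..<Suc h}"
      using Suc.prems h by auto
    have close': "scan_sum c u v l h (close_cuts j K) =
        (\<Sum>i\<le>l. scan_sum c ?u v i g (close_cuts j K) * ?b (l - i))" for j
      using Suc.IH[of "close_cuts j K" g] close_cuts_subset[OF Suc.prems, of j] h by simp
    have K0: "close_cuts h K = {}" "close_cuts g K = {}"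
      using close_cuts_empty[OF Suc.prems] h by auto
    let ?F = "\<lambda>j. scan_sum c u v l h (close_cuts j K)"
    let ?H = "\<lambda>i j. scan_sum c ?u v i g (close_cuts j K)"
    have "(\<Sum>j<Suc h. close_wt u v (Suc h) j * ?F j) = (\<Sum>j<h. v ^ j * ?F j) + u * v ^ h * ?F h"
      by (rule sum_close_split)
    \<comment> \<open>Closing either of the two lowest chords leaves no cuts, so both lead to the
      same state, and their weights merge: v^g + u v^(g+1) = (1 + u v) v^g.\<close>
    also have "\<dots> = (\<Sum>j<g. v ^ j * ?F j) + ?u * v ^ g * ?F g"
      using K0 by (simp add: h algebra_simps)
    also have "\<dots> = (\<Sum>j<h. close_wt ?u v h j * ?F j)"
      unfolding h sum_close_split ..
    also have "\<dots> = (\<Sum>j<h. \<Sum>i\<le>l. close_wt ?u v h j * ?H i j * ?b (l - i))"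
      unfolding close' by (simp add: sum_distrib_left mult.assoc)
    also have "\<dots> = (\<Sum>i\<le>l. (\<Sum>j<h. close_wt ?u v h j * ?H i j) * ?b (l - i))"
      by (subst sum.swap) (simp add: sum_distrib_right)
    finally have cl: "(\<Sum>j<Suc h. close_wt u v (Suc h) j * ?F j) =
      (\<Sum>i\<le>l. (\<Sum>j<h. close_wt ?u v h j * ?H i j) * ?b (l - i))" .
    have "scan_sum c u v (Suc l) (Suc h) K =
        scan_sum c u v l (Suc (Suc h)) (insert 1 (Suc ` K)) + (\<Sum>j<Suc h. close_wt u v (Suc h) j * ?F j)"
      using scan_sum_step[of "Suc h" c K, OF _ nd] by (simp del: scan_sum.simps sum.lessThan_Suc)
    also have "\<dots> = (\<Sum>i\<le>l. scan_sum c ?u v (Suc i) h K * ?b (l - i))"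
      unfolding cl Suc.IH[OF open']
      using h by (simp add: sum.distrib[symmetric] distrib_right scan_sum_step[OF _ nd] del: sum.lessThan_Suc scan_sum.simps)
    also have "\<dots> = (\<Sum>i\<le>Suc l. scan_sum c ?u v i h K * ?b (Suc l - i))"
      by (rule conv_Suc[symmetric]) (simp add: h)
    finally show ?thesis .
  qed
qed

text \<open>
  The element h of the cut set says that the chord at the bottom is not yet linked to the chords
  above it. The terms at parameter 1 are the scans that never link it, which are to be discarded.
\<close>
lemma scan_sum_shift_separate:
  assumes "K \<subseteq> {..<h}"
  shows "scan_sum True u v l (Suc h) (insert h K) =
    (\<Sum>i\<le>l. (scan_sum True (1 + u * v) v i h K - scan_sum True 1 v i h K)
             * scan_sum True u v (l - i) 1 {})"
  using assms
proof (induction l arbitrary: h K)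
  case 0
  then show ?case by (cases h) auto
next
  case (Suc l)
  let ?u = "1 + u * v"
  let ?b = "\<lambda>i. scan_sum True u v i 1 {}"
  let ?d = "\<lambda>i h K. scan_sum True ?u v i h K - scan_sum True 1 v i h K"
  show ?case
  proof (cases "h = 0 \<or> 0 \<in> K")
    case True
    show ?thesis
    proof (cases "0 \<in> K")
      case True
      then show ?thesis by (simp add: scan_sum_dead del: sum.atMost_Suc)
    next
      case False
      with True have h: "h = 0" by simp
      with Suc.prems have K: "K = {}" by simp
      \<comment> \<open>The cut \<open>h\<close> = 0 is dead on the left; on the right a scan from
        height 0 does not depend on its first parameter, so the difference vanishes.\<close>
      show ?thesis unfolding h K
        by (simp add: scan_sum_dead scan_sum_no_open del: sum.atMost_Suc scan_sum.simps)
    qed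
  next
    case False
    then obtain g where h: "h = Suc g" by (cases h) auto
    have nd: "0 \<notin> K" using False by simp
    have open': "insert 1 (Suc ` K) \<subseteq> {..<Suc h}"
      using Suc.prems h by auto
    have open_eq: "insert 1 (Suc ` insert h K) = insert (Suc h) (insert 1 (Suc ` K))" by auto
    have close': "scan_sum True u v l h (close_cuts j (insert h K)) =
        (\<Sum>i\<le>l. ?d i g (close_cuts j K) * ?b (l - i))" if "j < h" for j
      unfolding close_cuts_insert[OF that]
      using Suc.IH[of "close_cuts j K" g] close_cuts_subset[OF Suc.prems, of j] h by simp
    have K0: "close_cuts g K = {}" "close_cuts h (insert h K) = {}"
      using Suc.prems h by (auto simp: close_cuts_def)
    \<comment> \<open>Closing the bottom chord itself spans its own cut and all others. From then on
      nothing has to be discarded, and the unrestricted shift applies.\<close>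
    have last: "scan_sum True u v l h {} = (\<Sum>i\<le>l. scan_sum True ?u v i g {} * ?b (l - i))"
      unfolding h by (rule scan_sum_shift) simp
    let ?F = "\<lambda>j. scan_sum True u v l h (close_cuts j (insert h K))"
    let ?H = "\<lambda>w i j. scan_sum True w v i g (close_cuts j K)"
    have clw: "(\<Sum>j<h. close_wt w v h j * ?H w i j) = (\<Sum>j<g. v ^ j * ?H w i j) + w * v ^ g * scan_sum True w v i g {}"
      for w i unfolding h sum_close_split using K0 by simp
    have "(\<Sum>j<Suc h. close_wt u v (Suc h) j * ?F j) = (\<Sum>j<h. v ^ j * ?F j) + u * v ^ h * ?F h"
      by (rule sum_close_split)
    also have "(\<Sum>j<h. v ^ j * ?F j) = (\<Sum>j<h. \<Sum>i\<le>l. v ^ j * ?d i g (close_cuts j K) * ?b (l - i))"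
      by (intro sum.cong) (simp_all add: close' sum_distrib_left mult.assoc del: scan_sum.simps)
    also have "\<dots> = (\<Sum>i\<le>l. (\<Sum>j<h. v ^ j * ?d i g (close_cuts j K)) * ?b (l - i))"
      by (subst sum.swap) (simp add: sum_distrib_right)
    also have "u * v ^ h * ?F h = (\<Sum>i\<le>l. u * v ^ h * scan_sum True ?u v i g {} * ?b (l - i))"
      unfolding K0 last by (simp add: sum_distrib_left mult.assoc)
    also have "(\<Sum>i\<le>l. (\<Sum>j<h. v ^ j * ?d i g (close_cuts j K)) * ?b (l - i)) + \<dots> =
      (\<Sum>i\<le>l. ((\<Sum>j<h. v ^ j * ?d i g (close_cuts j K)) + u * v ^ h * scan_sum True ?u v i g {}) * ?b (l - i))"
      by (simp add: sum.distrib[symmetric] distrib_right)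
    \<comment> \<open>Only the term j = g needs care. With X and Y the scans from \<open>{}\<close>
      at 1 + u v and at 1, v^g (X - Y) + u v^(g+1) X = (1 + u v) v^g X - 1 * v^g Y.\<close>
    also have "\<dots> = (\<Sum>i\<le>l. ((\<Sum>j<h. close_wt ?u v h j * ?H ?u i j) - (\<Sum>j<h. close_wt 1 v h j * ?H 1 i j)) * ?b (l - i))"
    proof (intro sum.cong refl arg_cong2[of _ _ _ _ "(*)"])
      fix i
      show "(\<Sum>j<h. v ^ j * ?d i g (close_cuts j K)) + u * v ^ h * scan_sum True ?u v i g {} =
        (\<Sum>j<h. close_wt ?u v h j * ?H ?u i j) - (\<Sum>j<h. close_wt 1 v h j * ?H 1 i j)"
        unfolding clw by (simp add: h K0 right_diff_distrib sum_subtractf algebra_simps)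
    qed
    finally have cl: "(\<Sum>j<Suc h. close_wt u v (Suc h) j * ?F j) =
      (\<Sum>i\<le>l. ((\<Sum>j<h. close_wt ?u v h j * ?H ?u i j) - (\<Sum>j<h. close_wt 1 v h j * ?H 1 i j)) * ?b (l - i))" .
    have "scan_sum True u v (Suc l) (Suc h) (insert h K) =
        scan_sum True u v l (Suc (Suc h)) (insert 1 (Suc ` insert h K)) + (\<Sum>j<Suc h. close_wt u v (Suc h) j * ?F j)"
      using nd h by (subst scan_sum.simps) (simp del: sum.lessThan_Suc)
    also have "\<dots> = (\<Sum>i\<le>l. ?d (Suc i) h K * ?b (l - i))"
      unfolding cl open_eq Suc.IH[OF open']
      using nd h by (simp add: sum.distrib[symmetric] algebra_simps del: sum.lessThan_Suc)
    also have "\<dots> = (\<Sum>i\<le>Suc l. ?d i h K * ?b (Suc l - i))"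
      by (rule conv_Suc[symmetric]) (simp add: h)
    finally show ?thesis .
  qed
qed

section \<open>From convolutions over points to convolutions over chords\<close>

lemma conv_odd:
  fixes a b :: "nat \<Rightarrow> 'a::comm_ring_1"
  assumes "\<And>i. even i \<Longrightarrow> a i = 0"
  shows "(\<Sum>i\<le>2 * m + 2. a i * b (2 * m + 2 - i)) = (\<Sum>i\<le>m. a (2 * i + 1) * b (2 * (m - i) + 1))"
proof -
  have "(\<Sum>i\<le>2 * m + 2. a i * b (2 * m + 2 - i)) = (\<Sum>i\<in>(\<lambda>i. 2 * i + 1) ` {..m}. a i * b (2 * m + 2 - i))"
  proof (rule sum.mono_neutral_right)
    show "\<forall>i\<in>{..2 * m + 2} - (\<lambda>i. 2 * i + 1) ` {..m}. a i * b (2 * m + 2 - i) = 0"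
    proof
      fix i assume i: "i \<in> {..2 * m + 2} - (\<lambda>i. 2 * i + 1) ` {..m}"
      have "even i"
      proof (rule ccontr)
        assume "odd i"
        then obtain k where "i = 2 * k + 1" by (rule oddE)
        with i show False by auto
      qed
      then show "a i * b (2 * m + 2 - i) = 0" using assms by simp
    qed
  qed auto
  also have "\<dots> = (\<Sum>i\<le>m. a (2 * i + 1) * b (2 * (m - i) + 1))"
    by (subst sum.reindex) (auto simp: inj_on_def intro!: sum.cong arg_cong2[of _ _ _ _ "(*)"] arg_cong[of _ _ b])
  finally show ?thesis .
qed

lemma scan_sum_odd_False:
  "scan_sum False u v (2 * Suc m + 1) 1 {} =
    (\<Sum>i\<le>m. scan_sum False (1 + u * v) v (2 * i + 1) 1 {} * scan_sum False u v (2 * (m - i) + 1) 1 {})"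
proof -
  \<comment> \<open>Closing the only open chord here would reach height 0 with points left, which
    has weight 0, so the next point must open. It creates the cut of size 1.\<close>
  have "scan_sum False u v (2 * Suc m + 1) 1 {} = scan_sum False u v (2 * m + 2) (Suc 1) {1}"
    by (simp del: scan_sum.simps add: scan_sum.simps(2)[of _ _ _ "Suc (Suc _)"] scan_sum.simps(2)[of _ _ _ _ 0])
  also have "\<dots> = scan_sum False u v (2 * m + 2) (Suc 1) {}" by (rule scan_sum_False)
  also have "\<dots> = (\<Sum>i\<le>2 * m + 2. scan_sum False (1 + u * v) v i 1 {} * scan_sum False u v (2 * m + 2 - i) 1 {})"
    by (rule scan_sum_shift) simp
  finally show ?thesis by (subst (asm) conv_odd) (simp_all add: scan_sum_parity)
qed

lemma scan_sum_odd_True: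
  "scan_sum True u v (2 * Suc m + 1) 1 {} =
    (\<Sum>i\<le>m. (scan_sum True (1 + u * v) v (2 * i + 1) 1 {} - scan_sum True 1 v (2 * i + 1) 1 {})
             * scan_sum True u v (2 * (m - i) + 1) 1 {})"
proof -
  have "scan_sum True u v (2 * Suc m + 1) 1 {} = scan_sum True u v (2 * m + 2) (Suc 1) {1}"
    by (simp del: scan_sum.simps add: scan_sum.simps(2)[of _ _ _ "Suc (Suc _)"] scan_sum.simps(2)[of _ _ _ _ 0])
  \<comment> \<open>The cut of size 1 separates the root chord from the second one: it is the marker
    \<open>h\<close> with \<open>h\<close> = 1 and \<open>K\<close> = \<open>{}\<close>.\<close>
  also have "\<dots> = (\<Sum>i\<le>2 * m + 2. (scan_sum True (1 + u * v) v i 1 {} - scan_sum True 1 v i 1 {}) * scan_sum True u v (2 * m + 2 - i) 1 {})"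
    by (rule scan_sum_shift_separate) simp
  finally show ?thesis by (subst (asm) conv_odd) (simp_all add: scan_sum_parity)
qed

section \<open>Scanning chord diagrams\<close>

text \<open>This is the state before point \<open>t\<close> is read: the points below
  \<open>t\<close> are known, and a chord ending at \<open>t\<close> still counts as open.\<close>

definition open_ends :: "(nat \<times> nat) set \<Rightarrow> nat \<Rightarrow> nat set" where
  "open_ends D t = {a. \<exists>b. (a, b) \<in> D \<and> a < t \<and> t \<le> b}"

definition closed_chords :: "(nat \<times> nat) set \<Rightarrow> nat \<Rightarrow> (nat \<times> nat) set" where
  "closed_chords D t = {x \<in> D. snd x < t}"

definition cuts :: "nat \<Rightarrow> (nat \<times> nat) set \<Rightarrow> nat set" where
  "cuts t Q = {p. 0 < p \<and> p < t \<and> \<not> (\<exists>a b. (a, b) \<in> Q \<and> a < p \<and> p \<le> b)}"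

text \<open>A cut \<open>p\<close> of size 0 means that the interval \<open>{p..<t}\<close>, which
  avoids the root point, is closed under the matching.\<close>

definition cut_sizes :: "nat \<Rightarrow> nat set \<Rightarrow> (nat \<times> nat) set \<Rightarrow> nat set" where
  "cut_sizes t U Q = (\<lambda>p. card {a \<in> U. p \<le> a}) ` cuts t Q"

text \<open>These are the states in which \<open>scan_sum\<close> is not forced to be 0 by its own
  tests before the last point, together with the dead-cut test at the end.\<close>

definition admissible :: "bool \<Rightarrow> nat \<Rightarrow> nat \<Rightarrow> nat set \<Rightarrow> (nat \<times> nat) set \<Rightarrow> bool" where
  "admissible c n t U Q \<longleftrightarrow> (t < 2 * n \<longrightarrow> U \<noteq> {}) \<and> \<not> (c \<and> 0 \<in> cut_sizes t U Q)"

definition covers :: "nat \<times> nat \<Rightarrow> nat \<Rightarrow> bool" where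
  "covers x p \<longleftrightarrow> fst x = p \<or> snd x = p"

definition partial_diagram :: "nat \<Rightarrow> nat set \<Rightarrow> (nat \<times> nat) set \<Rightarrow> bool" where
  "partial_diagram t U Q \<longleftrightarrow> U \<subseteq> {..<t} \<and> Q \<subseteq> {(a, b). a < b \<and> b < t} \<and>
     (\<forall>p \<in> U. \<forall>x \<in> Q. \<not> covers x p) \<and>
     (\<forall>p < t. p \<notin> U \<longrightarrow> (\<exists>!x. x \<in> Q \<and> covers x p))"

definition extensions :: "nat \<Rightarrow> nat \<Rightarrow> nat set \<Rightarrow> (nat \<times> nat) set \<Rightarrow> (nat \<times> nat) set set" where
  "extensions n t U Q = {D. chord_diagram n D \<and> open_ends D t = U \<and> closed_chords D t = Q}"

definition chord_wt :: "'a::comm_ring_1 \<Rightarrow> 'a \<Rightarrow> (nat \<times> nat) set \<Rightarrow> nat \<times> nat \<Rightarrow> 'a" where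
  "chord_wt u v D x =
     close_wt u v (card (open_ends D (snd x))) (card {a \<in> open_ends D (snd x). fst x < a})"

section \<open>Elementary facts on chord diagrams\<close>

lemma chord_diagram_less:
  "chord_diagram n D \<Longrightarrow> (a, b) \<in> D \<Longrightarrow> a < b \<and> b < 2 * n"
  unfolding chord_diagram_def by auto

lemma chord_diagram_cover:
  "chord_diagram n D \<Longrightarrow> p < 2 * n \<Longrightarrow> \<exists>x \<in> D. covers x p"
  unfolding chord_diagram_def covers_def by metis

lemma chord_diagram_unique:
  assumes "chord_diagram n D" "x \<in> D" "y \<in> D" "covers x p" "covers y p"
  shows "x = y"
proof -
  have "p < 2 * n"
    using assms chord_diagram_less[of n D "fst x" "snd x"] unfolding covers_def by force
  then show ?thesis
    using assms unfolding chord_diagram_def covers_def by blast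
qed

lemma chord_diagram_ends:
  assumes "chord_diagram n D" "(p, b) \<in> D"
  shows "(a, p) \<notin> D"
proof
  assume "(a, p) \<in> D"
  then show False
    using chord_diagram_unique[OF assms, of "(a, p)" p] chord_diagram_less[OF assms]
    by (auto simp: covers_def)
qed

lemma finite_chord_diagram:
  assumes "chord_diagram n D"
  shows "finite D"
proof -
  have "D \<subseteq> {..<2 * n} \<times> {..<2 * n}"
    using assms unfolding chord_diagram_def by force
  then show ?thesis by (rule finite_subset) simp
qed

lemma finite_chord_diagrams: "finite {D. chord_diagram n D}"
proof -
  have "{D. chord_diagram n D} \<subseteq> Pow ({..<2 * n} \<times> {..<2 * n})"
    unfolding chord_diagram_def by force
  then show ?thesis by (rule finite_subset) simp
qed

lemma finite_extensions: "finite (extensions n t U Q)"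
  using finite_chord_diagrams[of n] by (rule finite_subset[rotated]) (auto simp: extensions_def)

lemma finite_open_ends: "finite (open_ends D t)"
  by (rule finite_subset[of _ "{..<t}"]) (auto simp: open_ends_def)

section \<open>Reading one more point of a diagram\<close>

lemma extensions_open:
  assumes "partial_diagram t U Q"
  shows "extensions n (Suc t) (insert t U) Q =
    {D \<in> extensions n t U Q. \<exists>b. (t, b) \<in> D}" (is "?L = ?R")
proof (intro subset_antisym subsetI)
  fix D assume D: "D \<in> ?L"
  then have cd: "chord_diagram n D" and o: "open_ends D (Suc t) = insert t U" and q: "closed_chords D (Suc t) = Q"
    by (auto simp: extensions_def)
  have "t \<in> open_ends D (Suc t)" using o by simp
  then obtain b where b: "(t, b) \<in> D" unfolding open_ends_def by auto
  have nt: "snd x \<noteq> t" if "x \<in> D" for x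
    using chord_diagram_ends[OF cd b, of "fst x"] that by (cases x) auto
  have "closed_chords D t = Q" using q nt unfolding closed_chords_def by (auto simp: less_Suc_eq)
  moreover have "open_ends D (Suc t) - {t} = open_ends D t"
    using nt unfolding open_ends_def by (force simp: less_Suc_eq Suc_le_eq order_less_le)
  then have "open_ends D t = U" using o assms unfolding partial_diagram_def by auto
  ultimately show "D \<in> ?R" using cd b by (auto simp: extensions_def)
next
  fix D assume D: "D \<in> ?R"
  then have cd: "chord_diagram n D" and o: "open_ends D t = U" and q: "closed_chords D t = Q"
    by (auto simp: extensions_def)
  obtain b where b: "(t, b) \<in> D" using D by auto
  have nt: "snd x \<noteq> t" if "x \<in> D" for x
    using chord_diagram_ends[OF cd b, of "fst x"] that by (cases x) auto
  have "closed_chords D (Suc t) = Q" using q nt unfolding closed_chords_def by (auto simp: less_Suc_eq)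
  moreover have "open_ends D (Suc t) = insert t (open_ends D t)"
    using nt b chord_diagram_less[OF cd b]
    unfolding open_ends_def by (force simp: less_Suc_eq Suc_le_eq order_less_le)
  ultimately show "D \<in> ?L" using cd o by (auto simp: extensions_def)
qed

lemma extensions_close:
  assumes "partial_diagram t U Q" "a \<in> U"
  shows "extensions n (Suc t) (U - {a}) (insert (a, t) Q) =
    {D \<in> extensions n t U Q. (a, t) \<in> D}" (is "?L = ?R")
proof (intro subset_antisym subsetI)
  fix D assume D: "D \<in> ?L"
  then have cd: "chord_diagram n D" and o: "open_ends D (Suc t) = U - {a}" and q: "closed_chords D (Suc t) = insert (a, t) Q"
    by (auto simp: extensions_def)
  have at: "(a, t) \<in> D" using q unfolding closed_chords_def by auto
  have nt: "x = (a, t)" if "x \<in> D" "covers x t" for x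
    using chord_diagram_unique[OF cd that(1) at that(2)] by (auto simp: covers_def)
  have snd_less: "snd x < Suc t \<and> x \<noteq> (a, t) \<longleftrightarrow> snd x < t" if "x \<in> D" for x
    using nt[OF that] by (cases "x = (a, t)") (auto simp: less_Suc_eq covers_def)
  then have "closed_chords D t = closed_chords D (Suc t) - {(a, t)}"
    unfolding closed_chords_def by blast
  moreover have "(a, t) \<notin> Q" using assms unfolding partial_diagram_def by auto
  ultimately have "closed_chords D t = Q" using q by auto
  moreover have "open_ends D t = insert a (open_ends D (Suc t))"
  proof (intro subset_antisym subsetI)
    fix x assume "x \<in> open_ends D t"
    then obtain b where "(x, b) \<in> D" "x < t" "t \<le> b" unfolding open_ends_def by auto
    then show "x \<in> insert a (open_ends D (Suc t))"
      using nt[of "(x, b)"] unfolding open_ends_def by (cases "b = t") (auto simp: covers_def)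
  next
    fix x assume "x \<in> insert a (open_ends D (Suc t))"
    then consider "x = a" | b where "(x, b) \<in> D" "x < Suc t" "Suc t \<le> b" unfolding open_ends_def by auto
    then show "x \<in> open_ends D t"
    proof cases
      case 1
      then show ?thesis using at chord_diagram_less[OF cd at] unfolding open_ends_def by auto
    next
      case 2
      then show ?thesis using nt[of "(x, b)"] unfolding open_ends_def by (cases "x = t") (auto simp: covers_def)
    qed
  qed
  ultimately show "D \<in> ?R" using cd at o assms(2) by (auto simp: extensions_def)
next
  fix D assume D: "D \<in> ?R"
  then have cd: "chord_diagram n D" and o: "open_ends D t = U" and q: "closed_chords D t = Q" and at: "(a, t) \<in> D"
    by (auto simp: extensions_def)
  have nt: "x = (a, t)" if "x \<in> D" "covers x t" for x
    using chord_diagram_unique[OF cd that(1) at that(2)] by (auto simp: covers_def)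
  have snd_less: "snd x < Suc t \<and> x \<noteq> (a, t) \<longleftrightarrow> snd x < t" if "x \<in> D" for x
    using nt[OF that] by (cases "x = (a, t)") (auto simp: less_Suc_eq covers_def)
  then have "closed_chords D t = closed_chords D (Suc t) - {(a, t)}"
    unfolding closed_chords_def by blast
  moreover have "(a, t) \<in> closed_chords D (Suc t)" using at by (simp add: closed_chords_def)
  ultimately have "closed_chords D (Suc t) = insert (a, t) (closed_chords D t)" by blast
  moreover have "open_ends D (Suc t) = open_ends D t - {a}"
  proof (intro subset_antisym subsetI)
    fix x assume "x \<in> open_ends D t - {a}"
    then obtain b where "(x, b) \<in> D" "x < t" "t \<le> b" "x \<noteq> a" unfolding open_ends_def by auto
    then show "x \<in> open_ends D (Suc t)"
      using nt[of "(x, b)"] unfolding open_ends_def by (cases "b = t") (auto simp: covers_def)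
  next
    fix x assume "x \<in> open_ends D (Suc t)"
    then obtain b where b: "(x, b) \<in> D" "x < Suc t" "Suc t \<le> b" unfolding open_ends_def by auto
    then have "x \<noteq> a" using chord_diagram_unique[OF cd b(1) at, of a] by (auto simp: covers_def)
    moreover have "x \<noteq> t" using nt[of "(x, b)"] b by (auto simp: covers_def)
    ultimately show "x \<in> open_ends D t - {a}" using b unfolding open_ends_def by auto
  qed
  ultimately show "D \<in> ?L" using cd o q by (auto simp: extensions_def)
qed

lemma extensions_cases:
  assumes "D \<in> extensions n t U Q" "t < 2 * n"
  shows "(\<exists>b. (t, b) \<in> D) \<or> (\<exists>a \<in> U. (a, t) \<in> D)"
proof -
  have cd: "chord_diagram n D" and o: "open_ends D t = U" using assms by (auto simp: extensions_def)
  obtain x where x: "x \<in> D" "covers x t" using chord_diagram_cover[OF cd assms(2)] by blast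
  obtain a b where ab: "x = (a, b)" by (cases x)
  show ?thesis
  proof (cases "a = t")
    case True
    then show ?thesis using x ab by auto
  next
    case False
    then have "b = t" using x ab by (auto simp: covers_def)
    then have "a \<in> U" using o x ab chord_diagram_less[OF cd, of a b] unfolding open_ends_def by auto
    then show ?thesis using x ab \<open>b = t\<close> by auto
  qed
qed

lemma partial_diagram_open:
  assumes "partial_diagram t U Q"
  shows "partial_diagram (Suc t) (insert t U) Q"
  using assms unfolding partial_diagram_def by (force simp: less_Suc_eq covers_def)

lemma partial_diagram_close:
  assumes "partial_diagram t U Q" "a \<in> U"
  shows "partial_diagram (Suc t) (U - {a}) (insert (a, t) Q)"
  unfolding partial_diagram_def
proof (intro conjI ballI allI impI)
  have U: "U \<subseteq> {..<t}" and Q: "Q \<subseteq> {(a, b). a < b \<and> b < t}"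
    and nc: "\<And>p x. p \<in> U \<Longrightarrow> x \<in> Q \<Longrightarrow> \<not> covers x p"
    and ex: "\<And>p. p < t \<Longrightarrow> p \<notin> U \<Longrightarrow> (\<exists>!x. x \<in> Q \<and> covers x p)"
    using assms unfolding partial_diagram_def by auto
  show "U - {a} \<subseteq> {..<Suc t}" using U by auto
  show "insert (a, t) Q \<subseteq> {(a, b). a < b \<and> b < Suc t}" using U Q assms(2) by auto
  show "\<not> covers x p" if "p \<in> U - {a}" "x \<in> insert (a, t) Q" for p x
    using that U nc[of p x] by (auto simp: covers_def)
  show "\<exists>!x. x \<in> insert (a, t) Q \<and> covers x p" if p: "p < Suc t" "p \<notin> U - {a}" for p
  proof (cases "p = a \<or> p = t")
    case True
    have "\<not> covers x p" if "x \<in> Q" for x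
      using True that nc[of a x] assms(2) Q by (auto simp: covers_def)
    then show ?thesis using True by (intro ex1I[of _ "(a, t)"]) (auto simp: covers_def)
  next
    case False
    then have "p < t" "p \<notin> U" using p by auto
    with ex have "\<exists>!x. x \<in> Q \<and> covers x p" by blast
    moreover have "x \<in> insert (a, t) Q \<and> covers x p \<longleftrightarrow> x \<in> Q \<and> covers x p" for x
      using False by (auto simp: covers_def)
    ultimately show ?thesis by simp
  qed
qed

lemma partial_diagram_complete:
  assumes "partial_diagram (2 * n) {} Q"
  shows "chord_diagram n Q"
  using assms unfolding partial_diagram_def chord_diagram_def covers_def by auto

lemma scan_end:
  assumes "chord_diagram n D"
  shows "open_ends D (2 * n) = {}" "closed_chords D (2 * n) = D"
  using chord_diagram_less[OF assms] unfolding open_ends_def closed_chords_def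
  by (auto simp: not_le[symmetric])

section \<open>Evolution of the cut sizes\<close>

lemma cut_sizes_open:
  assumes "partial_diagram t U Q" "0 < t"
  shows "cut_sizes (Suc t) (insert t U) Q = insert 1 (Suc ` cut_sizes t U Q)"
proof -
  have U: "U \<subseteq> {..<t}" and Q: "Q \<subseteq> {(a, b). a < b \<and> b < t}"
    using assms unfolding partial_diagram_def by auto
  have fin: "finite U" using U finite_subset by auto
  \<comment> \<open>The new cut lies just before the opening point \<open>t\<close>. It is positive
    by assumption, and no closed chord reaches it.\<close>
  have cuts: "cuts (Suc t) Q = insert t (cuts t Q)"
    using Q assms(2) unfolding cuts_def by (auto simp: less_Suc_eq)
  have "{a \<in> insert t U. t \<le> a} = {t}" using U by auto
  moreover have "card {a \<in> insert t U. p \<le> a} = Suc (card {a \<in> U. p \<le> a})" if "p \<in> cuts t Q" for p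
  proof -
    have "{a \<in> insert t U. p \<le> a} = insert t {a \<in> U. p \<le> a}" using that by (auto simp: cuts_def)
    then show ?thesis using U fin by (auto simp: card_insert_if)
  qed
  ultimately show ?thesis unfolding cut_sizes_def cuts image_insert image_image by simp
qed

lemma cut_sizes_close:
  assumes "partial_diagram t U Q" "a \<in> U"
  shows "cut_sizes (Suc t) (U - {a}) (insert (a, t) Q) =
    close_cuts (card {b \<in> U. a < b}) (cut_sizes t U Q)"
proof -
  have U: "U \<subseteq> {..<t}" and Q: "Q \<subseteq> {(a, b). a < b \<and> b < t}"
    using assms unfolding partial_diagram_def by auto
  have fin: "finite U" using U finite_subset by auto
  have cuts: "cuts (Suc t) (insert (a, t) Q) = {p \<in> cuts t Q. p \<le> a}"
  proof (rule set_eqI)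
    fix p
    have "a < t" using U assms(2) by auto
    moreover have "(\<exists>a' b. (a', b) \<in> insert (a, t) Q \<and> a' < p \<and> p \<le> b) \<longleftrightarrow>
      (a < p \<and> p \<le> t) \<or> (\<exists>a' b. (a', b) \<in> Q \<and> a' < p \<and> p \<le> b)" by auto
    ultimately show "p \<in> cuts (Suc t) (insert (a, t) Q) \<longleftrightarrow> p \<in> {p \<in> cuts t Q. p \<le> a}"
      unfolding cuts_def mem_Collect_eq by auto
  qed
  \<comment> \<open>Since \<open>a\<close> is itself open, whether a cut survives can be read off
    from its size alone. This is why the set of sizes is enough as a state.\<close>
  have iff: "card {b \<in> U. a < b} < card {b \<in> U. p \<le> b} \<longleftrightarrow> p \<le> a" for p
  proof
    assume "p \<le> a"
    then have "{b \<in> U. a < b} \<subset> {b \<in> U. p \<le> b}" using assms(2) by auto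
    then show "card {b \<in> U. a < b} < card {b \<in> U. p \<le> b}" using fin by (intro psubset_card_mono) auto
  next
    assume *: "card {b \<in> U. a < b} < card {b \<in> U. p \<le> b}"
    show "p \<le> a"
    proof (rule ccontr)
      assume "\<not> p \<le> a"
      then have "card {b \<in> U. p \<le> b} \<le> card {b \<in> U. a < b}" using fin by (intro card_mono) auto
      with * show False by simp
    qed
  qed
  have dec: "card {b \<in> U - {a}. p \<le> b} = card {b \<in> U. p \<le> b} - 1" if "p \<le> a" for p
  proof -
    have "{b \<in> U - {a}. p \<le> b} = {b \<in> U. p \<le> b} - {a}" by auto
    then show ?thesis using that assms(2) by simp
  qed
  show ?thesis
    unfolding cut_sizes_def close_cuts_def cuts using iff dec by (auto simp: image_iff)
qed

text \<open>An open chord is identified by the number of open chords opened after it, which turns a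
  sum over open chords into the sum over j < h of \<open>scan_sum\<close>.\<close>

lemma bij_betw_rank:
  fixes U :: "nat set"
  assumes "finite U"
  shows "bij_betw (\<lambda>a. card {b \<in> U. a < b}) U {..<card U}"
proof -
  let ?r = "\<lambda>a. card {b \<in> U. a < b}"
  have lt: "?r b < ?r a" if "a \<in> U" "b \<in> U" "a < b" for a b
    using assms that by (intro psubset_card_mono) auto
  have inj: "inj_on ?r U"
  proof (rule inj_onI)
    fix a b assume "a \<in> U" "b \<in> U" "?r a = ?r b"
    then show "a = b" using lt[of a b] lt[of b a] by (cases a b rule: linorder_cases) auto
  qed
  have "?r ` U \<subseteq> {..<card U}"
    using assms by (auto intro!: psubset_card_mono)
  then have "?r ` U = {..<card U}"
    by (rule card_subset_eq[rotated]) (use card_image[OF inj] in auto)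
  with inj show ?thesis unfolding bij_betw_def by blast
qed

text \<open>The total weight of all completions depends only on the number of open chords and the
  set of cut sizes. The induction on the number of points left sorts the completions by what point
  \<open>t\<close> does: it opens a chord or closes one of the chords in \<open>U\<close>.\<close>

lemma extensions_sum:
  fixes u v :: "'a::comm_ring_1"
  assumes "partial_diagram t U Q" "0 < t" "t + l = 2 * n"
  shows "(\<Sum>D \<in> {D \<in> extensions n t U Q. \<forall>s\<in>{t..2 * n}. admissible c n s (open_ends D s) (closed_chords D s)}.
            \<Prod>x\<in>{x \<in> D. t \<le> snd x}. chord_wt u v D x) =
         scan_sum c u v l (card U) (cut_sizes t U Q)"
  using assms
proof (induction l arbitrary: t U Q)
  case 0
  then have t: "t = 2 * n" by simp
  have fin: "finite U" using 0 finite_subset unfolding partial_diagram_def by auto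
  have ext: "D = Q \<and> U = {}" if "D \<in> extensions n t U Q" for D
  proof -
    have cd: "chord_diagram n D" and "open_ends D t = U" "closed_chords D t = Q"
      using that by (auto simp: extensions_def)
    then show ?thesis using scan_end[OF cd] t by simp
  qed
  show ?case
  proof (cases "U = {}")
    case True
    then have cd: "chord_diagram n Q" using partial_diagram_complete 0 t by simp
    have e: "open_ends Q t = {}" "closed_chords Q t = Q"
      using scan_end[OF cd] t by auto
    have none: "{x \<in> Q. t \<le> snd x} = {}"
    proof -
      have "snd x < t" if "x \<in> Q" for x using that e(2) unfolding closed_chords_def by blast
      then show ?thesis by (auto simp: not_le[symmetric])
    qed
    have "extensions n t U Q = {Q}"
      using ext cd e True unfolding extensions_def by blast
    then have set: "{D \<in> extensions n t U Q. \<forall>s\<in>{t..2 * n}. admissible c n s (open_ends D s) (closed_chords D s)} =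
        {D. D = Q \<and> \<not> (c \<and> 0 \<in> cut_sizes t {} Q)}"
      using e by (auto simp: t admissible_def)
    have "(\<Sum>D \<in> {D \<in> extensions n t U Q. \<forall>s\<in>{t..2 * n}. admissible c n s (open_ends D s) (closed_chords D s)}.
            \<Prod>x\<in>{x \<in> D. t \<le> snd x}. chord_wt u v D x) = (\<Sum>D \<in> {D. D = Q \<and> \<not> (c \<and> 0 \<in> cut_sizes t {} Q)}. 1)"
      unfolding set
    proof (rule sum.cong[OF refl])
      fix D assume "D \<in> {D. D = Q \<and> \<not> (c \<and> 0 \<in> cut_sizes t {} Q)}"
      then have "D = Q" by simp
      then show "(\<Prod>x\<in>{x \<in> D. t \<le> snd x}. chord_wt u v D x) = 1"
        by (simp only: none prod.empty)
    qed
    also have "\<dots> = (if \<not> (c \<and> 0 \<in> cut_sizes t {} Q) then 1 else 0)"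
      by (cases "c \<and> 0 \<in> cut_sizes t {} Q") auto
    finally show ?thesis using True by simp
  next
    case False
    then have "extensions n t U Q = {}" using ext by blast
    then show ?thesis using False fin by simp
  qed
next
  case (Suc l)
  note pd = Suc.prems(1)
  have U: "U \<subseteq> {..<t}" and Q: "Q \<subseteq> {(a, b). a < b \<and> b < t}"
    using pd unfolding partial_diagram_def by auto
  have fin: "finite U" using U finite_subset by auto
  have tn: "t < 2 * n" "Suc t + l = 2 * n" using Suc.prems by auto
  define A where "A t U Q = {D \<in> extensions n t U Q. \<forall>s\<in>{t..2 * n}. admissible c n s (open_ends D s) (closed_chords D s)}" for t U Q
  define W where "W t D = (\<Prod>x\<in>{x \<in> D. t \<le> snd x}. chord_wt u v D x)" for t D
  have IH: "sum (W (Suc t)) (A (Suc t) V R) = scan_sum c u v l (card V) (cut_sizes (Suc t) V R)"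
    if "partial_diagram (Suc t) V R" for V R
    unfolding A_def W_def using Suc.IH[OF that _ tn(2)] by simp
  have finA: "finite (A t U Q)" for t U Q unfolding A_def using finite_extensions by simp
  show ?case
  proof (cases "admissible c n t U Q")
    case False
    then have "A t U Q = {}" unfolding A_def extensions_def using tn by auto
    moreover have "scan_sum c u v (Suc l) (card U) (cut_sizes t U Q) = 0"
      using False tn fin by (auto simp: admissible_def)
    ultimately show ?thesis unfolding A_def[symmetric] by simp
  next
    case True
    have U0: "0 < card U" and nd: "\<not> (c \<and> 0 \<in> cut_sizes t U Q)"
      using True tn fin by (auto simp: admissible_def card_gt_0_iff)
    have ivl: "{t..2 * n} = insert t {Suc t..2 * n}" using tn by auto
    have Aalt: "A t U Q = {D \<in> extensions n t U Q. \<forall>s\<in>{Suc t..2 * n}. admissible c n s (open_ends D s) (closed_chords D s)}"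
      unfolding A_def ivl using True by (auto simp: extensions_def)
    let ?O = "A (Suc t) (insert t U) Q"
    let ?C = "\<lambda>a. A (Suc t) (U - {a}) (insert (a, t) Q)"
    have O: "?O = {D \<in> A t U Q. \<exists>b. (t, b) \<in> D}"
      unfolding Aalt unfolding A_def extensions_open[OF pd] by auto
    have C: "?C a = {D \<in> A t U Q. (a, t) \<in> D}" if "a \<in> U" for a
      unfolding Aalt unfolding A_def extensions_close[OF pd that] by auto
    have cdA: "chord_diagram n D" if "D \<in> A t U Q" for D using that by (auto simp: A_def extensions_def)
    have cases_A: "(\<exists>b. (t, b) \<in> D) \<or> (\<exists>a \<in> U. (a, t) \<in> D)" if "D \<in> A t U Q" for D
    proof -
      have "D \<in> extensions n t U Q" using that by (simp add: A_def)
      from extensions_cases[OF this tn(1)] show ?thesis .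
    qed
    have CU: "(\<Union>a\<in>U. ?C a) = {D \<in> A t U Q. \<exists>a\<in>U. (a, t) \<in> D}"
    proof -
      have "(\<Union>a\<in>U. ?C a) = (\<Union>a\<in>U. {D \<in> A t U Q. (a, t) \<in> D})"
        using C by (rule SUP_cong[OF refl])
      then show ?thesis by blast
    qed
    have split: "A t U Q = ?O \<union> (\<Union>a\<in>U. ?C a)"
      unfolding O CU using cases_A by blast
    have disj: "?O \<inter> (\<Union>a\<in>U. ?C a) = {}"
    proof -
      have False if "D \<in> A t U Q" "(t, b) \<in> D" "(a, t) \<in> D" for D a b
        using chord_diagram_ends[OF cdA[OF that(1)] that(2)] that(3) by blast
      then show ?thesis unfolding O CU by blast
    qed
    have disjC: "?C a \<inter> ?C b = {}" if "a \<in> U" "b \<in> U" "a \<noteq> b" for a b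
    proof -
      have False if "D \<in> A t U Q" "(a, t) \<in> D" "(b, t) \<in> D" for D
        using chord_diagram_unique[OF cdA[OF that(1)] that(2,3), of t] \<open>a \<noteq> b\<close>
        by (auto simp: covers_def)
      then show ?thesis unfolding C[OF that(1)] C[OF that(2)] by blast
    qed
    \<comment> \<open>No chord ends at \<open>t\<close> if \<open>t\<close> opens one, so no factor
      is lost; in \<open>WC\<close> the only factor lost is that of the chord
      \<open>(a, t)\<close>.\<close>
    have WO: "W t D = W (Suc t) D" if D: "D \<in> ?O" for D
    proof -
      obtain b where b: "D \<in> A t U Q" "(t, b) \<in> D" using D O by auto
      have "snd x \<noteq> t" if "x \<in> D" for x
        using chord_diagram_ends[OF cdA[OF b(1)] b(2), of "fst x"] that by (cases x) auto
      then have "{x \<in> D. t \<le> snd x} = {x \<in> D. Suc t \<le> snd x}" by (auto simp: order_le_less Suc_le_eq)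
      then show ?thesis unfolding W_def by simp
    qed
    have WC: "W t D = close_wt u v (card U) (card {b \<in> U. a < b}) * W (Suc t) D"
      if D: "D \<in> ?C a" and a: "a \<in> U" for D a
    proof -
      have b: "D \<in> A t U Q" "(a, t) \<in> D" using D C[OF a] by auto
      have "t \<le> snd x \<longleftrightarrow> x = (a, t) \<or> Suc t \<le> snd x" if "x \<in> D" for x
        using chord_diagram_unique[OF cdA[OF b(1)] b(2) that, of t]
        by (cases x) (auto simp: covers_def)
      then have *: "{x \<in> D. t \<le> snd x} = insert (a, t) {x \<in> D. Suc t \<le> snd x}"
        using b(2) by blast
      have "open_ends D t = U" using b(1) by (auto simp: A_def extensions_def)
      then have "chord_wt u v D (a, t) = close_wt u v (card U) (card {b \<in> U. a < b})"
        by (simp add: chord_wt_def)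
      then show ?thesis
        unfolding W_def * using finite_chord_diagram[OF cdA[OF b(1)]] by (subst prod.insert) auto
    qed
    have "sum (W t) (A t U Q) = sum (W t) ?O + (\<Sum>a\<in>U. sum (W t) (?C a))"
      unfolding split using disj disjC fin finA
      by (subst sum.union_disjoint) (auto intro!: sum.UNION_disjoint)
    also have "sum (W t) ?O = sum (W (Suc t)) ?O" using WO by (rule sum.cong[OF refl])
    also have "\<dots> = scan_sum c u v l (Suc (card U)) (insert 1 (Suc ` cut_sizes t U Q))"
    proof -
      have "card (insert t U) = Suc (card U)" using U fin by (intro card_insert_disjoint) auto
      then show ?thesis
        using IH[OF partial_diagram_open[OF pd]] cut_sizes_open[OF pd Suc.prems(2)] by simp
    qed
    also have "(\<Sum>a\<in>U. sum (W t) (?C a)) =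
        (\<Sum>a\<in>U. close_wt u v (card U) (card {b \<in> U. a < b}) *
           scan_sum c u v l (card U - 1) (close_cuts (card {b \<in> U. a < b}) (cut_sizes t U Q)))"
    proof (rule sum.cong[OF refl])
      fix a assume a: "a \<in> U"
      have "sum (W t) (?C a) = close_wt u v (card U) (card {b \<in> U. a < b}) * sum (W (Suc t)) (?C a)"
        unfolding sum_distrib_left using WC a by (intro sum.cong) auto
      then show "sum (W t) (?C a) = close_wt u v (card U) (card {b \<in> U. a < b}) *
           scan_sum c u v l (card U - 1) (close_cuts (card {b \<in> U. a < b}) (cut_sizes t U Q))"
        using IH[OF partial_diagram_close[OF pd a]] cut_sizes_close[OF pd a] a by simp
    qed
    also have "\<dots> = (\<Sum>j<card U. close_wt u v (card U) j *
           scan_sum c u v l (card U - 1) (close_cuts j (cut_sizes t U Q)))"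
      by (rule sum.reindex_bij_betw[OF bij_betw_rank[OF fin],
        of "\<lambda>j. close_wt u v (card U) j * scan_sum c u v l (card U - 1) (close_cuts j (cut_sizes t U Q))"])
    finally show ?thesis
      unfolding A_def[symmetric] W_def[symmetric] scan_sum_step[OF U0 nd] .
  qed
qed

section \<open>Connectedness and statistics along the scan\<close>

lemma open_ends_empty_iff: "open_ends D t = {} \<longleftrightarrow> (\<forall>x\<in>D. snd x < t \<or> t \<le> fst x)"
  unfolding open_ends_def by (fastforce simp: not_le not_less)

text \<open>A cut point decomposes the diagram iff no chord is open there; at \<open>s\<close> =
  \<open>2 * n\<close> the condition is vacuous.\<close>

lemma indecomposable_iff_admissible:
  "indecomposable n D \<longleftrightarrow> (\<forall>s\<in>{1..2 * n}. admissible False n s (open_ends D s) (closed_chords D s))"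
  unfolding indecomposable_def open_ends_empty_iff[symmetric] admissible_def
  by (auto simp: Suc_le_eq)

text \<open>The right-hand side expresses that no chord joins \<open>{p..<s}\<close> to its
  complement: the first clause excludes chords entering from the left, the second those leaving to
  the right.\<close>

lemma zero_in_cut_sizes_iff:
  assumes "chord_diagram n D"
  shows "0 \<in> cut_sizes s (open_ends D s) (closed_chords D s) \<longleftrightarrow>
    (\<exists>p. 0 < p \<and> p < s \<and>
      (\<forall>(a, b)\<in>D. (a < p \<and> p \<le> b \<longrightarrow> s \<le> b) \<and> (p \<le> a \<and> a < s \<longrightarrow> b < s)))" (is "_ \<longleftrightarrow> ?R")
proof -
  have c0: "0 = card {a \<in> open_ends D s. p \<le> a} \<longleftrightarrow> (\<forall>a\<in>open_ends D s. a < p)" for p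
    using finite_open_ends[of D s] by (auto simp: not_le)
  have "0 \<in> cut_sizes s (open_ends D s) (closed_chords D s) \<longleftrightarrow>
      (\<exists>p. p \<in> cuts s (closed_chords D s) \<and> (\<forall>a\<in>open_ends D s. a < p))"
    unfolding cut_sizes_def image_iff c0 by blast
  also have "\<dots> \<longleftrightarrow> ?R"
  proof (intro arg_cong[of _ _ Ex] ext)
    fix p
    have "(\<forall>a\<in>open_ends D s. a < p) \<longleftrightarrow> (\<forall>(a, b)\<in>D. p \<le> a \<and> a < s \<longrightarrow> b < s)"
      unfolding open_ends_def by (fastforce simp: not_le not_less)
    moreover have "p \<in> cuts s (closed_chords D s) \<longleftrightarrow> 0 < p \<and> p < s \<and> (\<forall>(a, b)\<in>D. a < p \<and> p \<le> b \<longrightarrow> s \<le> b)"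
      unfolding cuts_def closed_chords_def by (fastforce simp: not_le not_less)
    ultimately show "(p \<in> cuts s (closed_chords D s) \<and> (\<forall>a\<in>open_ends D s. a < p)) =
        (0 < p \<and> p < s \<and>
      (\<forall>(a, b)\<in>D. (a < p \<and> p \<le> b \<longrightarrow> s \<le> b) \<and> (p \<le> a \<and> a < s \<longrightarrow> b < s)))"
      by blast
  qed
  finally show ?thesis .
qed

lemma connected_cd_invariant:
  assumes "connected_cd D" "x \<in> D" "y \<in> D" "P x"
    and step: "\<And>x y. x \<in> D \<Longrightarrow> y \<in> D \<Longrightarrow> crosses x y \<Longrightarrow> P x \<Longrightarrow> P y"
  shows "P y"
proof -
  have "(x, y) \<in> {(x, y). x \<in> D \<and> y \<in> D \<and> crosses x y}\<^sup>*"
    using assms(1-3) unfolding connected_cd_def by blast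
  then show ?thesis by (induction rule: rtrancl_induct) (use assms(4) step in auto)
qed

text \<open>Crossing chords lie on the same side of a point that no chord spans, and both inside or
  both outside an interval closed under the matching. In either case a path of crossings joining the
  root chord to a suitable second chord \<open>z\<close> gives a contradiction.\<close>

lemma connected_imp_admissible:
  assumes cd: "chord_diagram n D" and conn: "connected_cd D" and s: "0 < s" "s \<le> 2 * n"
  shows "admissible True n s (open_ends D s) (closed_chords D s)"
proof -
  have less: "fst x < snd x" "snd x < 2 * n" if "x \<in> D" for x
    using chord_diagram_less[OF cd, of "fst x" "snd x"] that by auto
  obtain r where r: "r \<in> D" "covers r 0"
    using chord_diagram_cover[OF cd, of 0] s by auto
  have r0: "fst r = 0" using r less[of r] by (auto simp: covers_def)
  have "open_ends D s \<noteq> {}" if "s < 2 * n"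
  proof
    assume "open_ends D s = {}"
    then have side: "snd x < s \<or> s \<le> fst x" if "x \<in> D" for x
      using that by (simp add: open_ends_empty_iff)
    obtain z where z: "z \<in> D" "covers z s"
      using chord_diagram_cover[OF cd \<open>s < 2 * n\<close>] by auto
    have "snd z < s"
    proof (rule connected_cd_invariant[OF conn r(1) z(1), where P = "\<lambda>x. snd x < s"])
      show "snd r < s" using side[OF r(1)] r0 s by auto
      show "snd y < s" if "x \<in> D" "y \<in> D" "crosses x y" "snd x < s" for x y
        using that side[OF that(2)] unfolding crosses_def by auto
    qed
    then show False using z less[OF z(1)] by (auto simp: covers_def)
  qed
  moreover have "0 \<notin> cut_sizes s (open_ends D s) (closed_chords D s)"
  proof
    assume "0 \<in> cut_sizes s (open_ends D s) (closed_chords D s)"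
    then obtain p where p: "0 < p" "p < s" and
      closed: "\<forall>(a, b)\<in>D. (a < p \<and> p \<le> b \<longrightarrow> s \<le> b) \<and> (p \<le> a \<and> a < s \<longrightarrow> b < s)"
      unfolding zero_in_cut_sizes_iff[OF cd] by blast
    have side: "fst x < p \<Longrightarrow> p \<le> snd x \<Longrightarrow> s \<le> snd x"
      "p \<le> fst x \<Longrightarrow> fst x < s \<Longrightarrow> snd x < s" if "x \<in> D" for x
      using bspec[OF closed that] by (cases x; simp)+
    obtain z where z: "z \<in> D" "covers z p"
      using chord_diagram_cover[OF cd, of p] p s by auto
    have "p \<le> fst r \<and> snd r < s"
    proof (rule connected_cd_invariant[OF conn z(1) r(1), where P = "\<lambda>x. p \<le> fst x \<and> snd x < s"])
      show "p \<le> fst z \<and> snd z < s" using side[OF z(1)] less[OF z(1)] z(2) p by (auto simp: covers_def)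
      show "p \<le> fst y \<and> snd y < s" if "x \<in> D" "y \<in> D" "crosses x y" "p \<le> fst x \<and> snd x < s" for x y
        using that side[OF that(2)] unfolding crosses_def by linarith
    qed
    then show False using r0 p by simp
  qed
  ultimately show ?thesis unfolding admissible_def by simp
qed

lemma crosses_sym: "crosses x y \<Longrightarrow> crosses y x"
  unfolding crosses_def by blast

text \<open>One end of \<open>z\<close> lies within \<open>y\<close> and hence within
  \<open>d\<close>; if the other end lay outside \<open>d\<close>, then \<open>z\<close> and
  \<open>d\<close> would cross.\<close>

lemma below_crossing:
  assumes "crosses y z" "below y d" "\<not> crosses z d" "fst z \<noteq> fst d" "snd z \<noteq> snd d"
  shows "below z d"
  using assms unfolding crosses_def below_def by (elim disjE) linarith+

text \<open>
  The hull of the points of a component is closed under the matching: a chord outside the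
  component has all of the component on one of its sides.
\<close>
lemma not_connected_imp_not_admissible:
  assumes cd: "chord_diagram n D" and n: "0 < n" and nconn: "\<not> connected_cd D"
  shows "\<exists>s\<in>{1..2 * n}. \<not> admissible True n s (open_ends D s) (closed_chords D s)"
proof -
  have less: "fst x < snd x" "snd x < 2 * n" if "x \<in> D" for x
    using chord_diagram_less[OF cd, of "fst x" "snd x"] that by auto
  define R where "R = {(x, y). x \<in> D \<and> y \<in> D \<and> crosses x y}"
  have symR: "sym (R\<^sup>*)"
    by (rule sym_rtrancl) (auto simp: R_def sym_def intro: crosses_sym)
  obtain r where r: "r \<in> D" "covers r 0"
    using chord_diagram_cover[OF cd, of 0] n by auto
  \<comment> \<open>If every chord were linked to the root chord, symmetry and transitivity would
    connect the diagram. So there is a component that misses the root.\<close>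
  have "\<exists>x\<in>D. (x, r) \<notin> R\<^sup>*"
  proof (rule ccontr)
    assume "\<not> ?thesis"
    then have "(x, y) \<in> R\<^sup>*" if "x \<in> D" "y \<in> D" for x y
      using that symR by (meson rtrancl_trans symD)
    then show False using nconn unfolding connected_cd_def R_def by blast
  qed
  then obtain x where x: "x \<in> D" "(x, r) \<notin> R\<^sup>*" by blast
  define K where "K = {y. (x, y) \<in> R\<^sup>*}"
  have KD: "K \<subseteq> D"
  proof
    fix y assume "y \<in> K"
    then have "(x, y) \<in> R\<^sup>*" by (simp add: K_def)
    then show "y \<in> D" by (induction rule: rtrancl_induct) (auto simp: R_def x)
  qed
  have finK: "finite K" using finite_subset[OF KD finite_chord_diagram[OF cd]] .
  have xK: "x \<in> K" by (simp add: K_def)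
  \<comment> \<open>The hull of the component \<open>K\<close> is \<open>{p..q}\<close>; the dead
    cut \<open>p\<close> appears at the scan position \<open>Suc q\<close>.\<close>
  define p where "p = Min (fst ` K)"
  define q where "q = Max (snd ` K)"
  have "p \<in> fst ` K" "q \<in> snd ` K"
    unfolding p_def q_def using finK xK by (auto intro!: Min_in Max_in)
  then obtain y1 y2 where y1: "y1 \<in> K" "fst y1 = p" and y2: "y2 \<in> K" "snd y2 = q" by auto
  have pq: "p \<le> fst y" "snd y \<le> q" if "y \<in> K" for y
    unfolding p_def q_def using finK that by auto
  have noncross: "\<not> crosses y d" if "d \<in> D - K" "y \<in> K" for d y
  proof
    assume "crosses y d"
    then have "(y, d) \<in> R" using that KD by (auto simp: R_def)
    then have "d \<in> K" using that by (auto simp: K_def intro: rtrancl_into_rtrancl)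
    then show False using that by blast
  qed
  have ends: "fst y \<noteq> fst d" "fst y \<noteq> snd d" "snd y \<noteq> fst d" "snd y \<noteq> snd d"
    if "d \<in> D - K" "y \<in> K" for d y
  proof -
    have "y \<in> D" "d \<in> D" "y \<noteq> d" using that KD by auto
    then have "\<not> (covers y e \<and> covers d e)" for e
      using chord_diagram_unique[OF cd] by blast
    then show "fst y \<noteq> fst d" "fst y \<noteq> snd d" "snd y \<noteq> fst d" "snd y \<noteq> snd d"
      unfolding covers_def by metis+
  qed
  \<comment> \<open>Being nested under an outside chord \<open>d\<close> propagates along crossings,
    so \<open>d\<close> lies above all chords of the component or above none.\<close>
  have inside: "below y d \<longleftrightarrow> below x d" if d: "d \<in> D - K" and y: "y \<in> K" for d y
  proof -
    have "(x, y) \<in> R\<^sup>*" using y by (simp add: K_def)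
    then show ?thesis
    proof (induction rule: rtrancl_induct)
      case (step y z)
      have yK: "y \<in> K" using step.hyps by (simp add: K_def)
      have zK: "z \<in> K" using step.hyps by (auto simp: K_def intro: rtrancl_into_rtrancl)
      have "crosses y z" using step.hyps by (simp add: R_def)
      then have "below y d \<longleftrightarrow> below z d"
        using below_crossing[of y z d] below_crossing[of z y d] crosses_sym
          noncross[OF d yK] noncross[OF d zK] ends[OF d yK] ends[OF d zK] by blast
      with step.IH show ?case by simp
    qed simp
  qed
  have closed: "(fst d < p \<and> p \<le> snd d \<longrightarrow> Suc q \<le> snd d) \<and> (p \<le> fst d \<and> fst d < Suc q \<longrightarrow> snd d < Suc q)"
    if "d \<in> D" for d
  proof (cases "d \<in> K")
    case True
    then show ?thesis using pq[OF True] by auto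
  next
    case False
    with that have d: "d \<in> D - K" by simp
    show ?thesis
    \<comment> \<open>If \<open>d\<close> lies above the component, it spans the whole hull.
      Otherwise it cannot straddle \<open>p\<close> or \<open>q\<close>, since it would then enclose
      or cross \<open>y1\<close> or \<open>y2\<close>, the chords that reach these ends.\<close>
    proof (cases "below x d")
      case True
      then have "below y1 d" "below y2 d" using inside[OF d] y1 y2 by auto
      then show ?thesis using y1 y2 by (auto simp: below_def)
    next
      case False
      then have nb: "\<not> below y1 d" "\<not> below y2 d" using inside[OF d] y1 y2 by auto
      have "\<not> (fst d < p \<and> p \<le> snd d)"
        using nb(1) noncross[OF d y1(1)] ends[OF d y1(1)] y1(2)
        unfolding crosses_def below_def by linarith
      moreover have "\<not> (fst d \<le> q \<and> q < snd d)"
        using nb(2) noncross[OF d y2(1)] ends[OF d y2(1)] y2(2)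
        unfolding crosses_def below_def by linarith
      ultimately show ?thesis by auto
    qed
  qed
  have "r \<notin> K" using x by (simp add: K_def)
  have "0 < p"
  proof (rule ccontr)
    assume "\<not> 0 < p"
    then have "covers y1 0" using y1 by (simp add: covers_def)
    then have "y1 = r" using chord_diagram_unique[OF cd _ r(1) _ r(2)] y1 KD by blast
    then show False using y1 \<open>r \<notin> K\<close> by simp
  qed
  moreover have "p < Suc q" using pq[OF xK] less[OF x(1)] by auto
  ultimately have "0 \<in> cut_sizes (Suc q) (open_ends D (Suc q)) (closed_chords D (Suc q))"
    unfolding zero_in_cut_sizes_iff[OF cd] using closed by (intro exI[of _ p]) auto
  moreover have "Suc q \<in> {1..2 * n}" using y2 less[of y2] KD by auto
  ultimately show ?thesis unfolding admissible_def by blast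
qed

lemma connected_iff_admissible:
  assumes "chord_diagram n D" "0 < n"
  shows "connected_cd D \<longleftrightarrow> (\<forall>s\<in>{1..2 * n}. admissible True n s (open_ends D s) (closed_chords D s))"
  using connected_imp_admissible[OF assms(1)] not_connected_imp_not_admissible[OF assms]
  by fastforce

section \<open>Top chords and crossings read off at the closing points\<close>

lemma top_chord_iff:
  assumes cd: "chord_diagram n D" and x: "x \<in> D"
  shows "Suc (card {a \<in> open_ends D (snd x). fst x < a}) = card (open_ends D (snd x)) \<longleftrightarrow> \<not> (\<exists>d\<in>D. below x d)"
proof -
  obtain a b where ab: "x = (a, b)" by (cases x)
  have less: "a < b" using chord_diagram_less[OF cd] x ab by auto
  let ?G = "{c \<in> open_ends D b. a < c}" and ?L = "{c \<in> open_ends D b. c < a}"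
  \<comment> \<open>At the closing point of \<open>x\<close> the open chords are \<open>x\<close>,
    those opened later and those opened earlier. The earlier ones close after \<open>x\<close>, so
    they are exactly the chords above it.\<close>
  have "open_ends D b = insert a (?G \<union> ?L)"
    using x ab less by (auto simp: open_ends_def)
  moreover have "card (insert a (?G \<union> ?L)) = Suc (card ?G + card ?L)"
    using finite_open_ends[of D b] by (subst card_insert_disjoint) (auto intro: card_Un_disjoint)
  ultimately have "card (open_ends D b) = Suc (card ?G + card ?L)" by simp
  moreover have "card ?L = 0 \<longleftrightarrow> \<not> (\<exists>d\<in>D. below x d)"
  proof -
    have "c \<in> ?L \<longleftrightarrow> (\<exists>d. (c, d) \<in> D \<and> c < a \<and> b < d)" for c
    proof -
      have "d \<noteq> b" if "(c, d) \<in> D" "c < a" for d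
        using chord_diagram_unique[OF cd that(1), of "(a, b)" b] x ab that by (auto simp: covers_def)
      then show ?thesis using less unfolding open_ends_def by (auto simp: order_le_less)
    qed
    then have "?L = {} \<longleftrightarrow> \<not> (\<exists>d\<in>D. below x d)"
      unfolding below_def ab by (auto simp: set_eq_iff)
    then show ?thesis using finite_open_ends[of D b] by simp
  qed
  ultimately show ?thesis unfolding ab by auto
qed

text \<open>Each crossing pair is counted once, at the chord that closes first: \<open>N x\<close>
  collects the chords that open within \<open>x\<close> and close after it.\<close>

lemma cr_eq_sum:
  assumes cd: "chord_diagram n D"
  shows "cr D = (\<Sum>x\<in>D. card {a \<in> open_ends D (snd x). fst x < a})"
proof -
  have fin: "finite D" using finite_chord_diagram[OF cd] .
  define N where "N x = {y \<in> D. fst x < fst y \<and> fst y < snd x \<and> snd x < snd y}" for x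
  have cardN: "card (N x) = card {a \<in> open_ends D (snd x). fst x < a}" if "x \<in> D" for x
  proof (rule bij_betw_same_card)
    show "bij_betw fst (N x) {a \<in> open_ends D (snd x). fst x < a}"
      unfolding bij_betw_def
    proof
      show "inj_on fst (N x)"
      proof (rule inj_onI)
        fix y z assume "y \<in> N x" "z \<in> N x" "fst y = fst z"
        then show "y = z"
          using chord_diagram_unique[OF cd, of y z "fst y"] by (simp add: N_def covers_def)
      qed
      show "fst ` N x = {a \<in> open_ends D (snd x). fst x < a}"
      proof (intro subset_antisym subsetI)
        fix c assume "c \<in> fst ` N x"
        then show "c \<in> {a \<in> open_ends D (snd x). fst x < a}" unfolding N_def open_ends_def by auto
      next
        fix c assume "c \<in> {a \<in> open_ends D (snd x). fst x < a}"
        then obtain d where d: "(c, d) \<in> D" "c < snd x" "snd x \<le> d" "fst x < c" unfolding open_ends_def by auto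
        have "d \<noteq> snd x"
          using chord_diagram_unique[OF cd d(1) \<open>x \<in> D\<close>, of "snd x"] d
          by (cases x) (auto simp: covers_def)
        then have "(c, d) \<in> N x" using d by (auto simp: N_def)
        then show "c \<in> fst ` N x" by force
      qed
    qed
  qed
  have "{{c1, c2} | c1 c2. c1 \<in> D \<and> c2 \<in> D \<and> crosses c1 c2} = (\<lambda>(x, y). {x, y}) ` Sigma D N"
  proof (intro subset_antisym subsetI)
    fix e assume "e \<in> {{c1, c2} | c1 c2. c1 \<in> D \<and> c2 \<in> D \<and> crosses c1 c2}"
    then obtain c1 c2 where e: "e = {c1, c2}" "c1 \<in> D" "c2 \<in> D" "crosses c1 c2" by blast
    then consider "(c1, c2) \<in> Sigma D N" | "(c2, c1) \<in> Sigma D N" unfolding crosses_def N_def by auto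
    then show "e \<in> (\<lambda>(x, y). {x, y}) ` Sigma D N"
    proof cases
      case 1
      then show ?thesis unfolding e(1) by (intro image_eqI[of _ _ "(c1, c2)"]) auto
    next
      case 2
      then show ?thesis unfolding e(1) by (intro image_eqI[of _ _ "(c2, c1)"]) auto
    qed
  next
    fix e assume "e \<in> (\<lambda>(x, y). {x, y}) ` Sigma D N"
    then obtain c1 c2 where "e = {c1, c2}" "c1 \<in> D" "c2 \<in> N c1" by auto
    then show "e \<in> {{c1, c2} | c1 c2. c1 \<in> D \<and> c2 \<in> D \<and> crosses c1 c2}"
      unfolding N_def crosses_def by blast
  qed
  moreover have "inj_on (\<lambda>(x, y). {x, y}) (Sigma D N)"
    unfolding inj_on_def N_def by (auto simp: doubleton_eq_iff)
  ultimately have "cr D = card (Sigma D N)"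
    unfolding cr_def by (simp add: card_image)
  also have "\<dots> = (\<Sum>x\<in>D. card (N x))"
    using fin by (intro card_SigmaI) (auto simp: N_def)
  finally show ?thesis using cardN by simp
qed

lemma diagram_weight:
  assumes cd: "chord_diagram n D"
  shows "u ^ top_chords D * v ^ cr D = (\<Prod>x\<in>D. chord_wt u v D x)"
proof -
  have "(\<Prod>x\<in>D. chord_wt u v D x) =
      (\<Prod>x\<in>D. (if \<not> (\<exists>d\<in>D. below x d) then u else 1) * v ^ card {a \<in> open_ends D (snd x). fst x < a})"
    unfolding chord_wt_def close_wt_def using top_chord_iff[OF cd] by (intro prod.cong) auto
  also have "\<dots> = u ^ top_chords D * v ^ cr D"
    unfolding prod.distrib top_chords_def cr_eq_sum[OF cd] power_sum
    using finite_chord_diagram[OF cd] by (simp add: prod.inter_filter[symmetric])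
  finally show ?thesis ..
qed

section \<open>Coefficients as scans, and the functional equations\<close>

lemma admissible_diagrams_sum:
  "(\<Sum>D \<in> {D. chord_diagram (Suc m) D \<and>
        (\<forall>s\<in>{1..2 * Suc m}. admissible c (Suc m) s (open_ends D s) (closed_chords D s))}.
      u ^ top_chords D * v ^ cr D) = scan_sum c u v (2 * m + 1) 1 {}"
proof -
  \<comment> \<open>The scan starts after the root point: one chord is open, nothing is closed and
    there is no cut yet. Every diagram passes through this state, so all diagrams are extensions of
    it.\<close>
  have start: "open_ends D 1 = {0} \<and> closed_chords D 1 = {} \<and> {x \<in> D. 1 \<le> snd x} = D" if cd: "chord_diagram (Suc m) D" for D
  proof -
    have less: "fst x < snd x" if "x \<in> D" for x
      using chord_diagram_less[OF cd, of "fst x" "snd x"] that by auto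
    obtain r where r: "r \<in> D" "covers r 0"
      using chord_diagram_cover[OF cd, of 0] by auto
    then have "(0, snd r) \<in> D" "0 < snd r" using less[of r] by (cases r; auto simp: covers_def)+
    then have "open_ends D 1 = {0}" unfolding open_ends_def by auto
    then show ?thesis using less unfolding closed_chords_def by fastforce
  qed
  have ext: "extensions (Suc m) 1 {0} {} = {D. chord_diagram (Suc m) D}"
    using start unfolding extensions_def by auto
  have pd: "partial_diagram 1 {0} {}" unfolding partial_diagram_def by auto
  have "cut_sizes 1 {0} {} = {}" unfolding cut_sizes_def cuts_def by auto
  then have "scan_sum c u v (2 * m + 1) 1 {} =
      (\<Sum>D \<in> {D \<in> {D. chord_diagram (Suc m) D}. \<forall>s\<in>{1..2 * Suc m}. admissible c (Suc m) s (open_ends D s) (closed_chords D s)}.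
            \<Prod>x\<in>{x \<in> D. 1 \<le> snd x}. chord_wt u v D x)"
    using extensions_sum[OF pd, where l = "2 * m + 1" and n = "Suc m" and c = c and u = u and v = v] unfolding ext by simp
  also have "\<dots> = (\<Sum>D \<in> {D. chord_diagram (Suc m) D \<and>
        (\<forall>s\<in>{1..2 * Suc m}. admissible c (Suc m) s (open_ends D s) (closed_chords D s))}.
      u ^ top_chords D * v ^ cr D)"
    using start by (intro sum.cong) (auto simp: diagram_weight)
  finally show ?thesis ..
qed

lemma B_coeff_scan: "B_coeff m u v = scan_sum False u v (2 * m + 1) 1 {}"
  unfolding B_coeff_def indecomposable_iff_admissible by (rule admissible_diagrams_sum)

lemma C_coeff_scan: "C_coeff m u v = scan_sum True u v (2 * m + 1) 1 {}"
  unfolding C_coeff_def admissible_diagrams_sum[symmetric]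
  using connected_iff_admissible by (intro sum.cong) auto

text \<open>The single chord, which gives the constant term of both equations.\<close>

lemma scan_sum_single: "scan_sum c u v (Suc 0) (Suc 0) {} = u"
  by (simp add: close_wt_def close_cuts_def)

lemma fps_nth_X_mult_mult:
  fixes F G :: "'a::comm_ring_1 fps"
  shows "fps_nth (fps_X * F * G) (Suc m) = (\<Sum>i\<le>m. fps_nth F i * fps_nth G (m - i))"
  unfolding mult.assoc by (simp add: fps_mult_nth[of F G] atLeast0AtMost)

theorem theorem6p4:
  fixes u v :: "'a::comm_ring_1"
  shows "B_gf u v = fps_const u + fps_X * B_gf (1 + u * v) v * B_gf u v \<and>
         C_gf u v = fps_const u + fps_X * (C_gf (1 + u * v) v - C_gf 1 v) * C_gf u v"
proof (intro conjI fps_ext)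
  fix k
  show "fps_nth (B_gf u v) k = fps_nth (fps_const u + fps_X * B_gf (1 + u * v) v * B_gf u v) k"
  proof (cases k)
    case 0
    then show ?thesis by (simp add: B_gf_def B_coeff_scan scan_sum_single del: scan_sum.simps)
  next
    case (Suc m)
    then show ?thesis
      using scan_sum_odd_False[of u v m]
      by (simp add: B_gf_def B_coeff_scan fps_nth_X_mult_mult del: scan_sum.simps)
  qed
  show "fps_nth (C_gf u v) k = fps_nth (fps_const u + fps_X * (C_gf (1 + u * v) v - C_gf 1 v) * C_gf u v) k"
  proof (cases k)
    case 0
    then show ?thesis by (simp add: C_gf_def C_coeff_scan scan_sum_single del: scan_sum.simps)
  next
    case (Suc m)
    then show ?thesis
      using scan_sum_odd_True[of u v m]
      by (simp add: C_gf_def C_coeff_scan fps_nth_X_mult_mult del: scan_sum.simps)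
  qed
qed

end
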